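(* Let $d\ge 2$ be an integer, let $\boldsymbol{\omega}\in\mathbb{R}^d$ with $\|\boldsymbol{\omega}\|=1$, let $L_{\boldsymbol{\omega}}=\{t\boldsymbol{\omega}: t\in[0,1]\}$, and let $\mu_{\boldsymbol{\omega}}$ be the (one-dimensional) Lebesgue measure on $L_{\boldsymbol{\omega}}$. Let $\mathbf{a}=(a_n)_{n=1}^\infty$ be a sequence of complex numbers with $a_n=n^{o(1)}$ as $n\to\infty$. Then $$\int_{L_{\boldsymbol{\omega}}}|S_{\mathbf{a},d}(\mathbf{x};N)|^2\,d\mu_{\boldsymbol{\omega}}(\mathbf{x})\le N^{1+o(1)},\qquad N\to\infty.$$
   Context: $\|\cdot\|$ is the Euclidean norm, $\mathbf{e}(x)=\exp(2\pi i x)$. For $\mathbf{x}=(x_1,\ldots,x_d)\in\mathbb{R}^d$ and $N\in\mathbb{N}$, $S_{\mathbf{a},d}(\mathbf{x};N)=\sum_{n=1}^N a_n\,\mathbf{e}(x_1n+x_2n^2+\ldots+x_dn^d)$. $U=V^{o(1)}$ means that for every $\varepsilon>0$, $|U|\le V^{\varepsilon}$ once $V$ is large enough; $A(N)\le N^{c+o(1)}$ means that for every $\varepsilon>0$, $A(N)\le N^{c+\varepsilon}$ for all sufficiently large $N$. *)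

theory Defs
  imports "HOL-Analysis.Analysis"
begin

text \<open>
  Points of $d$-dimensional Euclidean space are of type \<open>real ^ 'd\<close> with \<open>d = CARD('d)\<close>.  The
  index type is linearly ordered, so its elements are the coordinates $1, \dots, d$ in
  increasing order, and \<open>coord_pos j\<close> is the position of \<open>j\<close> in that enumeration.
\<close>

definition coord_pos :: "'d::{finite,linorder} \<Rightarrow> nat" where
  "coord_pos j = card {..j}"

lemma bij_betw_coord_pos:
  "bij_betw coord_pos (UNIV :: 'd::{finite,linorder} set) {1..CARD('d)}"
proof -
  have sm: "coord_pos i < coord_pos j" if "i < j" for i j :: 'd
    unfolding coord_pos_def using that
    by (intro psubset_card_mono) (auto simp: psubset_eq)
  have inj: "inj (coord_pos :: 'd \<Rightarrow> nat)"
    by (intro injI) (metis sm less_irrefl linorder_neqE)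
  have "range (coord_pos :: 'd \<Rightarrow> nat) \<subseteq> {1..CARD('d)}"
    unfolding coord_pos_def by (auto simp: Suc_le_eq card_gt_0_iff intro!: card_mono)
  moreover have "card (range (coord_pos :: 'd \<Rightarrow> nat)) = CARD('d)"
    using inj by (rule card_image)
  ultimately have "range (coord_pos :: 'd \<Rightarrow> nat) = {1..CARD('d)}"
    by (intro card_subset_eq) auto
  with inj show ?thesis by (simp add: bij_betw_def)
qed

definition e :: "real \<Rightarrow> complex" where
  "e x = exp (2 * of_real pi * \<i> * of_real x)"

definition weyl_sum :: "(nat \<Rightarrow> complex) \<Rightarrow> real ^ 'd::{finite,linorder} \<Rightarrow> nat \<Rightarrow> complex" where
  "weyl_sum a x N = (\<Sum>n=1..N. a n * e (\<Sum>j\<in>UNIV. x $ j * real n ^ coord_pos j))"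

definition seg :: "real ^ 'd \<Rightarrow> (real ^ 'd) set" where
  "seg \<omega> = {t *\<^sub>R \<omega> | t. t \<in> {0..1}}"

text \<open>
  For a unit vector \<open>\<omega>\<close>, \<open>t \<mapsto> t \<omega>\<close> is an isometry from the real line onto the
  line spanned by \<open>\<omega>\<close>, so the image of Lebesgue measure is the one-dimensional Lebesgue
  measure (arc length) on that line.
\<close>

definition seg_measure :: "real ^ 'd \<Rightarrow> (real ^ 'd) measure" where
  "seg_measure \<omega> = restrict_space (distr lborel borel (\<lambda>t. t *\<^sub>R \<omega>)) (seg \<omega>)"

lemma seg_eq_closed_segment: "seg \<omega> = closed_segment 0 \<omega>"
  by (auto simp: seg_def closed_segment_def)

lemma emeasure_seg_measure:
  fixes \<omega> :: "real ^ 'd"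
  assumes "norm \<omega> = 1" and "0 \<le> s" "s \<le> t" "t \<le> 1"
  shows "emeasure (seg_measure \<omega>) (closed_segment (s *\<^sub>R \<omega>) (t *\<^sub>R \<omega>)) = ennreal (t - s)"
proof -
  have eq: "closed_segment (s *\<^sub>R \<omega>) (t *\<^sub>R \<omega>) = (\<lambda>u. u *\<^sub>R \<omega>) ` {s..t}"
    using closed_segment_linear_image[of "\<lambda>u. u *\<^sub>R \<omega>" s t] \<open>s \<le> t\<close>
    by (simp add: closed_segment_eq_real_ivl linear_scaleR_left)
  have vim: "(\<lambda>u. u *\<^sub>R \<omega>) -` ((\<lambda>u. u *\<^sub>R \<omega>) ` {s..t}) = {s..t}"
    using \<open>norm \<omega> = 1\<close> by (auto simp: image_iff)
  have sub: "closed_segment (s *\<^sub>R \<omega>) (t *\<^sub>R \<omega>) \<subseteq> seg \<omega>"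
    unfolding eq seg_def using assms by force
  have "emeasure (seg_measure \<omega>) (closed_segment (s *\<^sub>R \<omega>) (t *\<^sub>R \<omega>))
      = emeasure (distr lborel borel (\<lambda>u. u *\<^sub>R \<omega>)) (closed_segment (s *\<^sub>R \<omega>) (t *\<^sub>R \<omega>))"
    unfolding seg_measure_def using sub
    by (intro emeasure_restrict_space) (auto simp: seg_eq_closed_segment closed_segment_def[symmetric])
  also have "\<dots> = emeasure lborel ((\<lambda>u. u *\<^sub>R \<omega>) -` closed_segment (s *\<^sub>R \<omega>) (t *\<^sub>R \<omega>))"
    by (subst emeasure_distr) auto
  also have "\<dots> = ennreal (t - s)"
    unfolding eq vim using \<open>s \<le> t\<close> by simp
  finally show ?thesis .
qed

text \<open>$U(n) = n^{o(1)}$ and $A(N) \le N^{c + o(1)}$, respectively.\<close>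

definition eq_powr_o1 :: "(nat \<Rightarrow> complex) \<Rightarrow> bool" where
  "eq_powr_o1 U \<longleftrightarrow> (\<forall>\<epsilon>>0. \<forall>\<^sub>F n in sequentially. cmod (U n) \<le> real n powr \<epsilon>)"

definition le_powr_o1 :: "(nat \<Rightarrow> real) \<Rightarrow> real \<Rightarrow> bool" where
  "le_powr_o1 A c \<longleftrightarrow> (\<forall>\<epsilon>>0. \<forall>\<^sub>F N in sequentially. A N \<le> real N powr (c + \<epsilon>))"

end

theory Submission
  imports Defs "HOL-Real_Asymp.Real_Asymp"
begin

text \<open>
  On the segment, the phases of the Weyl sum at $t\omega$ are $tP(n)$ for a fixed nonconstant real
  polynomial $P$.  Expanding the square, the terms $m, n$ contribute at most
  $|a_m a_n| \min(1, |P(m) - P(n)|^{-1})$ to the integral.  Since $|P'|$ is eventually bounded away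
  from $0$, the values $P(n)$ are separated at least linearly from some $n_0$ on, so
  the double sum over $m, n \le N$ is $O(N \log N)$ up to the factor $N^{o(1)}$ coming from $a$.
\<close>

section \<open>Separation of polynomial values\<close>

text \<open>The derivative again has a positive leading coefficient, so from some point on it is at
  least that coefficient, which serves as \<open>c\<close>; the mean value theorem does the
  rest.\<close>

lemma poly_increasing_at_least_linearly:
  fixes p :: "real poly"
  assumes "degree p > 0" and "lead_coeff p > 0"
  obtains c x0 where "c > 0" and "\<And>x y. x0 \<le> x \<Longrightarrow> x \<le> y \<Longrightarrow> c * (y - x) \<le> poly p y - poly p x"
proof -
  have "lead_coeff (pderiv p) = of_nat (degree p) * lead_coeff p"
    using assms(1) by (simp add: coeff_pderiv degree_pderiv)
  then have pos: "lead_coeff (pderiv p) > 0"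
    using assms by simp
  then obtain x0 where x0: "\<And>x. x \<ge> x0 \<Longrightarrow> lead_coeff (pderiv p) \<le> poly (pderiv p) x"
    using poly_pinfty_gt_lc by blast
  show thesis
  proof (rule that[OF pos])
    fix x y assume xy: "x0 \<le> x" "x \<le> y"
    show "lead_coeff (pderiv p) * (y - x) \<le> poly p y - poly p x"
    proof (cases "x = y")
      case False
      with xy have "x < y" by simp
      from poly_MVT[OF this, of p] obtain z
        where z: "x < z" "poly p y - poly p x = (y - x) * poly (pderiv p) z" by blast
      show ?thesis
        using x0[of z] z xy by (simp add: mult.commute mult_left_mono)
    qed simp
  qed
qed

text \<open>Replacing \<open>p\<close> by \<open>- p\<close> when the leading coefficient is
  negative changes no distance between values, which reduces the claim to the increasing
  case.\<close>

lemma poly_separation: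
  fixes p :: "real poly"
  assumes "degree p > 0"
  obtains c x0 where "c > 0"
    and "\<And>x y. x0 \<le> x \<Longrightarrow> x0 \<le> y \<Longrightarrow> c * \<bar>x - y\<bar> \<le> \<bar>poly p x - poly p y\<bar>"
proof -
  define q where "q = (if lead_coeff p > 0 then p else - p)"
  have q: "degree q > 0" "lead_coeff q > 0"
    using assms leading_coeff_0_iff[of p] by (auto simp: q_def not_less simp del: leading_coeff_0_iff)
  have abs_q: "\<bar>poly q x - poly q y\<bar> = \<bar>poly p x - poly p y\<bar>" for x y
    by (simp add: q_def abs_minus_commute)
  from poly_increasing_at_least_linearly[OF q] obtain c x0 where c: "c > 0"
    and mono: "\<And>x y. x0 \<le> x \<Longrightarrow> x \<le> y \<Longrightarrow> c * (y - x) \<le> poly q y - poly q x" by blast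
  show thesis
  proof (rule that[OF c])
    fix x y assume xy: "x0 \<le> x" "x0 \<le> y"
    show "c * \<bar>x - y\<bar> \<le> \<bar>poly p x - poly p y\<bar>"
    proof (cases "x \<le> y")
      case True
      then have "c * \<bar>x - y\<bar> = c * (y - x)" by simp
      also have "\<dots> \<le> poly q y - poly q x" using mono xy True by blast
      also have "\<dots> \<le> \<bar>poly p x - poly p y\<bar>" unfolding abs_q[symmetric] by linarith
      finally show ?thesis .
    next
      case False
      then have "c * \<bar>x - y\<bar> = c * (x - y)" by simp
      also have "\<dots> \<le> poly q x - poly q y" using mono xy False by simp
      also have "\<dots> \<le> \<bar>poly p x - poly p y\<bar>" unfolding abs_q[symmetric] by linarith
      finally show ?thesis .
    qed
  qed
qed

section \<open>Oscillatory integrals and expansion of the square\<close>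

lemma cmod_e [simp]: "cmod (e x) = 1"
proof -
  have "e x = exp (\<i> * of_real (2 * pi * x))"
    by (simp add: e_def mult_ac)
  then show ?thesis by (simp only: norm_exp_i_times)
qed

lemma e_mult_cnj: "e x * cnj (e y) = e (x - y)"
  by (simp add: e_def exp_cnj flip: exp_add) (simp add: algebra_simps)

lemma continuous_on_e [continuous_intros]:
  "continuous_on S f \<Longrightarrow> continuous_on S (\<lambda>t. e (f t))"
  unfolding e_def by (intro continuous_intros)

text \<open>The first bound is trivial since the integrand has modulus 1; the second comes from the
  antiderivative. Writing it as a product keeps it meaningful at \<open>y = 0\<close>.\<close>

lemma integral_e_bound:
  "cmod (integral {0..1} (\<lambda>t. e (t * y))) \<le> 1"
  "\<bar>y\<bar> * cmod (integral {0..1} (\<lambda>t. e (t * y))) \<le> 1"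
proof -
  have "cmod (integral {0..1} (\<lambda>t. e (t * y))) \<le> 1 * (1 - 0)"
    by (intro integral_bound continuous_intros) auto
  then show "cmod (integral {0..1} (\<lambda>t. e (t * y))) \<le> 1" by simp
  show "\<bar>y\<bar> * cmod (integral {0..1} (\<lambda>t. e (t * y))) \<le> 1"
  proof (cases "y = 0")
    case False
    define w where "w = 2 * of_real pi * \<i> * of_real y"
    have w: "w \<noteq> 0" "cmod w = 2 * pi * \<bar>y\<bar>"
      using False by (auto simp: w_def norm_mult)
    have e_w: "e (t * y) = exp (w * of_real t)" for t
      by (simp add: e_def w_def mult_ac)
    have "((\<lambda>t. e (t * y)) has_integral (exp (w * of_real 1) / w - exp (w * of_real 0) / w)) {0..1}"
      unfolding e_w using w(1)
      by (intro fundamental_theorem_of_calculus)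
         (auto intro!: derivative_eq_intros has_vector_derivative_real_field simp: field_simps)
    then have "integral {0..1} (\<lambda>t. e (t * y)) = (e y - 1) / w"
      using e_w[of 1] by (simp add: integral_unique diff_divide_distrib)
    then have "\<bar>y\<bar> * cmod (integral {0..1} (\<lambda>t. e (t * y))) = cmod (e y - 1) / (2 * pi)"
      using False by (simp add: norm_divide w)
    \<comment> \<open>The factor \<open>2 * pi\<close> in the denominator exceeds this numerator
      bound, hence the clean constant 1.\<close>
    moreover have "cmod (e y - 1) \<le> 2"
      using norm_triangle_ineq4[of "e y" 1] by simp
    then have "cmod (e y - 1) \<le> 2 * pi"
      using pi_gt3 by linarith
    ultimately show ?thesis by simp
  qed simp
qed

text \<open>The square is the sum times its conjugate. Integrating the finite double sum termwise,
  in the complex numbers because single terms are not real, leaves only the triangle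
  inequality.\<close>

lemma integral_cmod_exp_sum_squared_le:
  fixes a :: "nat \<Rightarrow> complex" and \<phi> :: "nat \<Rightarrow> real"
  shows "integral {0..1} (\<lambda>t. (cmod (\<Sum>n\<in>A. a n * e (t * \<phi> n)))\<^sup>2)
    \<le> (\<Sum>m\<in>A. \<Sum>n\<in>A. cmod (a m) * cmod (a n) * cmod (integral {0..1} (\<lambda>t. e (t * (\<phi> m - \<phi> n)))))"
proof -
  let ?S = "\<lambda>t. \<Sum>n\<in>A. a n * e (t * \<phi> n)"
  have expand: "complex_of_real ((cmod (?S t))\<^sup>2)
      = (\<Sum>m\<in>A. \<Sum>n\<in>A. (a m * cnj (a n)) * e (t * (\<phi> m - \<phi> n)))" for t
  proof -
    have "(a m * e (t * \<phi> m)) * cnj (a n * e (t * \<phi> n))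
        = (a m * cnj (a n)) * e (t * (\<phi> m - \<phi> n))" for m n
      by (simp add: right_diff_distrib flip: e_mult_cnj)
    then show ?thesis
      by (simp only: complex_norm_square cnj_sum sum_product)
  qed
  have "(\<lambda>t. (cmod (?S t))\<^sup>2) integrable_on {0..1}"
    by (intro integrable_continuous_real continuous_intros)
  then have "complex_of_real (integral {0..1} (\<lambda>t. (cmod (?S t))\<^sup>2))
      = integral {0..1} (\<lambda>t. complex_of_real ((cmod (?S t))\<^sup>2))"
    by (intro integral_unique[symmetric] has_integral_of_real integrable_integral)
  also have "\<dots> = (\<Sum>m\<in>A. \<Sum>n\<in>A. (a m * cnj (a n)) * integral {0..1} (\<lambda>t. e (t * (\<phi> m - \<phi> n))))"
  proof -
    have "((\<lambda>t. e (t * y)) has_integral integral {0..1} (\<lambda>t. e (t * y))) {0..1}" for y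
      by (intro integrable_integral integrable_continuous_real continuous_intros)
    then show ?thesis
      unfolding expand
      \<comment> \<open>For infinite \<open>A\<close> the sums are 0 by convention.\<close>
      by (cases "finite A") (auto intro!: integral_unique has_integral_sum has_integral_mult_right)
  qed
  finally have "cmod (complex_of_real (integral {0..1} (\<lambda>t. (cmod (?S t))\<^sup>2)))
      \<le> (\<Sum>m\<in>A. \<Sum>n\<in>A. cmod (a m) * cmod (a n) * cmod (integral {0..1} (\<lambda>t. e (t * (\<phi> m - \<phi> n)))))"
    by (auto intro!: sum_norm_le simp: norm_mult)
  then show ?thesis by (simp only: norm_of_real)
qed

section \<open>Double sums over separated points\<close>

text \<open>The terms on either side of \<open>m\<close> form an initial piece of the harmonic sum,
  each at most \<open>harm N\<close>.\<close>

lemma sum_inverse_distance_le: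
  assumes "m \<le> N"
  shows "(\<Sum>n=1..N. 1 / \<bar>real m - real n\<bar>) \<le> 2 * harm N"
proof -
  have "(\<Sum>n\<in>{1..<m}. 1 / \<bar>real m - real n\<bar>) = (\<Sum>k\<in>{1..<m}. inverse (real k))"
    by (rule sum.reindex_bij_witness[where i = "\<lambda>k. m - k" and j = "\<lambda>n. m - n"])
       (auto simp: of_nat_diff divide_inverse)
  also have "\<dots> \<le> harm N"
    unfolding harm_def using assms by (intro sum_mono2) auto
  finally have "(\<Sum>n\<in>{1..<m}. 1 / \<bar>real m - real n\<bar>) \<le> harm N" .
  moreover have "(\<Sum>n\<in>{m<..N}. 1 / \<bar>real m - real n\<bar>) = (\<Sum>k=1..N - m. inverse (real k))"
    by (rule sum.reindex_bij_witness[where i = "\<lambda>k. m + k" and j = "\<lambda>n. n - m"])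
       (use assms in \<open>auto simp: of_nat_diff divide_inverse\<close>)
  then have "(\<Sum>n\<in>{m<..N}. 1 / \<bar>real m - real n\<bar>) \<le> harm N"
    using harm_mono[of "N - m" N, where 'a = real] by (simp add: harm_def)
  \<comment> \<open>The term \<open>n = m\<close> is \<open>1 / 0 = 0\<close>, so dropping it
    changes nothing.\<close>
  moreover have "(\<Sum>n=1..N. 1 / \<bar>real m - real n\<bar>)
      = (\<Sum>n\<in>{1..<m} \<union> {m<..N}. 1 / \<bar>real m - real n\<bar>)"
    using assms by (intro sum.mono_neutral_right) (auto simp: not_less)
  ultimately show ?thesis
    using sum.union_disjoint[of "{1..<m}" "{m<..N}" "\<lambda>n. 1 / \<bar>real m - real n\<bar>"] by fastforce
qed

text \<open>Pairs with an index below \<open>n0\<close> number at most \<open>2 * n0 * N\<close> and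
  the diagonal has \<open>N\<close>; these are bounded by 1 each. All other pairs fall under the
  harmonic estimate.\<close>

lemma sum_separated_le:
  fixes K :: "nat \<Rightarrow> nat \<Rightarrow> real"
  assumes K1: "\<And>m n. K m n \<le> 1"
    and K2: "\<And>m n. n0 \<le> m \<Longrightarrow> n0 \<le> n \<Longrightarrow> m \<noteq> n \<Longrightarrow> K m n \<le> B / \<bar>real m - real n\<bar>"
    and "B \<ge> 0"
  shows "(\<Sum>m=1..N. \<Sum>n=1..N. K m n) \<le> real N * (2 * real n0 + 1 + 2 * B * harm N)"
proof -
  let ?D = "\<lambda>m n. B * (1 / \<bar>real m - real n\<bar>)"
  have D: "?D m n \<ge> 0" for m n
    using \<open>B \<ge> 0\<close> by simp
  \<comment> \<open>One majorant for all pairs: each exceptional condition pays 1, and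
    \<open>?D\<close> vanishes on the diagonal, so it may be summed over the full square.\<close>
  have K: "K m n \<le> of_bool (m < n0) + of_bool (n < n0) + of_bool (n = m) + ?D m n" for m n
  proof (cases "n0 \<le> m \<and> n0 \<le> n \<and> m \<noteq> n")
    case True
    then show ?thesis using K2[of m n] by simp
  next
    case False
    then have "(1::real) \<le> of_bool (m < n0) + of_bool (n < n0) + of_bool (n = m)"
      by (auto simp: of_bool_def)
    with K1[of m n] D[of m n] show ?thesis by linarith
  qed
  have card: "(\<Sum>n=1..N. of_bool (n < n0)) \<le> real n0"
  proof -
    have "(\<Sum>n=1..N. of_bool (n < n0)) = real (card {n\<in>{1..N}. n < n0})"
      by (simp add: sum.inter_filter[symmetric] of_bool_def)
    also have "\<dots> \<le> real (card {..<n0})"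
      by (intro of_nat_mono card_mono) auto
    finally show ?thesis by simp
  qed
  \<comment> \<open>A row with \<open>m < n0\<close> may cost \<open>N\<close>; the indicator is
    kept because at most \<open>n0\<close> rows are of this kind.\<close>
  have "(\<Sum>m=1..N. \<Sum>n=1..N. K m n)
      \<le> (\<Sum>m=1..N. real N * of_bool (m < n0) + (real n0 + 1 + 2 * B * harm N))"
  proof (rule sum_mono)
    fix m assume m: "m \<in> {1..N}"
    have "(\<Sum>n=1..N. K m n)
        \<le> (\<Sum>n=1..N. of_bool (m < n0) + of_bool (n < n0) + of_bool (n = m) + ?D m n)"
      by (intro sum_mono K)
    also have "\<dots> = real N * of_bool (m < n0) + (\<Sum>n=1..N. of_bool (n < n0)) + 1
        + B * (\<Sum>n=1..N. 1 / \<bar>real m - real n\<bar>)"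
      using m by (simp add: sum.distrib sum_distrib_left of_bool_def)
    also have "\<dots> \<le> real N * of_bool (m < n0) + (real n0 + 1 + 2 * B * harm N)"
      using card mult_left_mono[OF sum_inverse_distance_le[of m N] \<open>B \<ge> 0\<close>] m by simp
    finally show "(\<Sum>n=1..N. K m n)
        \<le> real N * of_bool (m < n0) + (real n0 + 1 + 2 * B * harm N)" .
  qed
  also have "\<dots> = real N * (\<Sum>m=1..N. of_bool (m < n0)) + real N * (real n0 + 1 + 2 * B * harm N)"
    by (simp add: sum.distrib sum_distrib_left)
  also have "\<dots> \<le> real N * real n0 + real N * (real n0 + 1 + 2 * B * harm N)"
    by (intro add_right_mono mult_left_mono card) auto
  finally show ?thesis by (simp add: algebra_simps)
qed

section \<open>Growth of the coefficients and of harmonic numbers\<close>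

text \<open>Since \<open>real n powr \<delta>\<close> is at least 1, a constant absorbs the finitely
  many indices where the asymptotic bound says nothing.\<close>

lemma eq_powr_o1_imp_bound:
  assumes "eq_powr_o1 a" and "\<delta> > 0"
  obtains C where "C > 0" and "\<And>n. n \<ge> 1 \<Longrightarrow> cmod (a n) \<le> C * real n powr \<delta>"
proof -
  from assms obtain M where M: "\<And>n. n \<ge> M \<Longrightarrow> cmod (a n) \<le> real n powr \<delta>"
    unfolding eq_powr_o1_def eventually_sequentially by blast
  define C where "C = 1 + (\<Sum>n<M. cmod (a n))"
  have C: "C \<ge> 1" by (simp add: C_def sum_nonneg)
  show thesis
  proof (rule that[of C])
    fix n :: nat assume n: "n \<ge> 1"
    then have pow: "real n powr \<delta> \<ge> 1"
      using \<open>\<delta> > 0\<close> by (simp add: ge_one_powr_ge_zero)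
    show "cmod (a n) \<le> C * real n powr \<delta>"
    proof (cases "n < M")
      case True
      then have "cmod (a n) \<le> (\<Sum>n<M. cmod (a n))"
        by (intro member_le_sum) auto
      then have "cmod (a n) \<le> C * 1" by (simp add: C_def)
      also have "\<dots> \<le> C * real n powr \<delta>"
        using pow C by (intro mult_left_mono) auto
      finally show ?thesis .
    next
      case False
      then have "cmod (a n) \<le> 1 * real n powr \<delta>" using M[of n] by simp
      also have "\<dots> \<le> C * real n powr \<delta>"
        using C by (intro mult_right_mono) auto
      finally show ?thesis .
    qed
  qed (use C in simp)
qed

text \<open>The sequence \<open>harm N - ln N\<close> decreases and equals 1 at
  \<open>N = 1\<close>.\<close>

lemma harm_le_ln: "N \<ge> 1 \<Longrightarrow> harm N \<le> 1 + ln (real N)"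
  using euler_mascheroni_sequence_decreasing[of 1 N] by (simp add: harm_expand)

section \<open>Mean square of sums with polynomial phases\<close>

lemma mean_square_exp_sum_poly:
  fixes a :: "nat \<Rightarrow> complex" and p :: "real poly"
  assumes "degree p > 0" and "eq_powr_o1 a"
  shows "le_powr_o1 (\<lambda>N. integral {0..1} (\<lambda>t. (cmod (\<Sum>n=1..N. a n * e (t * poly p (real n))))\<^sup>2)) 1"
  unfolding le_powr_o1_def
proof (intro allI impI)
  fix \<epsilon> :: real assume "\<epsilon> > 0"
  \<comment> \<open>The coefficients enter in pairs and cost \<open>N powr (2 * \<delta>)\<close>;
    the remaining \<open>N powr (2 * \<delta>)\<close> absorbs constants and the logarithm.\<close>
  define \<delta> where "\<delta> = \<epsilon> / 4"
  have \<delta>: "\<delta> > 0" "\<epsilon> = 4 * \<delta>" using \<open>\<epsilon> > 0\<close> by (auto simp: \<delta>_def)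
  from eq_powr_o1_imp_bound[OF assms(2) \<delta>(1)] obtain C
    where C: "C > 0" "\<And>n. n \<ge> 1 \<Longrightarrow> cmod (a n) \<le> C * real n powr \<delta>" by blast
  from poly_separation[OF assms(1)] obtain c x0 where c: "c > 0"
    and sep: "\<And>x y. x0 \<le> x \<Longrightarrow> x0 \<le> y \<Longrightarrow> c * \<bar>x - y\<bar> \<le> \<bar>poly p x - poly p y\<bar>" by blast
  define n0 where "n0 = nat \<lceil>x0\<rceil>"
  define K where "K = (\<lambda>m n. cmod (integral {0..1} (\<lambda>t. e (t * (poly p (real m) - poly p (real n))))))"
  have K1: "K m n \<le> 1" for m n
    by (simp add: K_def integral_e_bound)
  have K2: "K m n \<le> (1 / c) / \<bar>real m - real n\<bar>" if "n0 \<le> m" "n0 \<le> n" "m \<noteq> n" for m n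
  proof -
    have "x0 \<le> real m" "x0 \<le> real n" using that by (auto simp: n0_def)
    \<comment> \<open>Separation bounds the left side below by
      \<open>\<bar>poly p m - poly p n\<bar> * K m n\<close>, which is at most 1 by the second
      integral bound.\<close>
    from mult_right_mono[OF sep[OF this], of "K m n"]
    have "c * \<bar>real m - real n\<bar> * K m n \<le> 1"
      using integral_e_bound(2)[of "poly p (real m) - poly p (real n)"] by (simp add: K_def)
    with c that show ?thesis by (simp add: field_simps)
  qed
  \<comment> \<open>\<open>B\<close> merges the count of exceptional pairs with the harmonic
    coefficient, using \<open>1 \<le> 1 + ln N\<close> and
    \<open>harm N \<le> 1 + ln N\<close>.\<close>
  define B where "B = 2 * real n0 + 1 + 2 / c"
  have B: "B > 0" using c by (simp add: B_def add_nonneg_pos)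
  have bound: "integral {0..1} (\<lambda>t. (cmod (\<Sum>n=1..N. a n * e (t * poly p (real n))))\<^sup>2)
      \<le> (C * real N powr \<delta>)\<^sup>2 * (real N * (B * (1 + ln (real N))))" if "N \<ge> 1" for N
  proof -
    have a: "cmod (a n) \<le> C * real N powr \<delta>" if "n \<in> {1..N}" for n
    proof -
      have "cmod (a n) \<le> C * real n powr \<delta>" using C(2) that by simp
      also have "\<dots> \<le> C * real N powr \<delta>"
        using that C(1) \<delta>(1) by (intro mult_left_mono powr_mono2) auto
      finally show ?thesis .
    qed
    have "integral {0..1} (\<lambda>t. (cmod (\<Sum>n=1..N. a n * e (t * poly p (real n))))\<^sup>2)
        \<le> (\<Sum>m=1..N. \<Sum>n=1..N. cmod (a m) * cmod (a n) * K m n)"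
      unfolding K_def by (rule integral_cmod_exp_sum_squared_le)
    also have "\<dots> \<le> (\<Sum>m=1..N. \<Sum>n=1..N. (C * real N powr \<delta>) * (C * real N powr \<delta>) * K m n)"
      using C(1) by (intro sum_mono mult_right_mono mult_mono a) (auto simp: K_def)
    also have "\<dots> = (C * real N powr \<delta>)\<^sup>2 * (\<Sum>m=1..N. \<Sum>n=1..N. K m n)"
      by (simp add: sum_distrib_left power2_eq_square)
    also have "(\<Sum>m=1..N. \<Sum>n=1..N. K m n) \<le> real N * (2 * real n0 + 1 + 2 * (1 / c) * harm N)"
      using c by (intro sum_separated_le K1 K2) auto
    also have "2 * real n0 + 1 + 2 * (1 / c) * harm N \<le> B * (1 + ln (real N))"
    proof -
      have "(2 * real n0 + 1) * 1 + 2 * (1 / c) * harm N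
          \<le> (2 * real n0 + 1) * (1 + ln (real N)) + 2 * (1 / c) * (1 + ln (real N))"
        using c that by (intro add_mono mult_left_mono harm_le_ln) auto
      also have "\<dots> = B * (1 + ln (real N))"
        by (simp add: B_def algebra_simps)
      finally show ?thesis by simp
    qed
    finally show ?thesis by (simp add: mult_left_mono)
  qed
  have "\<forall>\<^sub>F N in sequentially.
      (C * real N powr \<delta>)\<^sup>2 * (real N * (B * (1 + ln (real N)))) \<le> real N powr (1 + 4 * \<delta>)"
    using \<delta>(1) C(1) B by real_asymp
  then show "\<forall>\<^sub>F N in sequentially.
      integral {0..1} (\<lambda>t. (cmod (\<Sum>n=1..N. a n * e (t * poly p (real n))))\<^sup>2) \<le> real N powr (1 + \<epsilon>)"
    using eventually_ge_at_top[of 1]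
    by eventually_elim (use bound \<delta>(2) order_trans in blast)
qed

section \<open>Transfer to the segment\<close>

text \<open>The phase at \<omega> as a polynomial in the summation index; by linearity of the phase
  in the point, the phase at \<open>t *\<^sub>R \<omega>\<close> is \<open>t\<close> times its
  value.\<close>

definition line_poly :: "real ^ 'd::{finite,linorder} \<Rightarrow> real poly" where
  "line_poly \<omega> = (\<Sum>j\<in>UNIV. monom (\<omega> $ j) (coord_pos j))"

text \<open>Distinct coordinates have distinct positions, so no monomials merge or cancel, and
  positions start at 1, so a nonzero coordinate gives a nonconstant term.\<close>

lemma degree_line_poly_pos:
  assumes "\<omega> \<noteq> 0"
  shows "degree (line_poly \<omega>) > 0"
proof -
  from assms obtain i where i: "\<omega> $ i \<noteq> 0"
    by (auto simp: vec_eq_iff)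
  have inj: "coord_pos j = coord_pos i \<longleftrightarrow> j = i" for j
    using bij_betw_coord_pos[where 'd = 'a] by (auto simp: bij_betw_def inj_eq)
  have "coeff (line_poly \<omega>) (coord_pos i) = \<omega> $ i"
    by (simp add: line_poly_def coeff_sum inj)
  with i have "coord_pos i \<le> degree (line_poly \<omega>)"
    by (intro le_degree) simp
  moreover have "coord_pos i \<ge> 1"
    using bij_betw_coord_pos[where 'd = 'a] by (auto simp: bij_betw_def)
  ultimately show ?thesis by simp
qed

lemma weyl_sum_scaleR:
  "weyl_sum a (t *\<^sub>R \<omega>) N = (\<Sum>n=1..N. a n * e (t * poly (line_poly \<omega>) (real n)))"
  by (simp add: weyl_sum_def line_poly_def poly_sum poly_monom sum_distrib_left mult_ac)

lemma continuous_on_weyl_sum [continuous_intros]: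
  "continuous_on S (\<lambda>x. weyl_sum a x N)"
  unfolding weyl_sum_def by (intro continuous_intros)

lemma integral_seg_measure:
  fixes f :: "real ^ 'd \<Rightarrow> real"
  assumes "norm \<omega> = 1" and "continuous_on UNIV f"
  shows "(\<integral>x. f x \<partial>(seg_measure \<omega>)) = integral {0..1} (\<lambda>t. f (t *\<^sub>R \<omega>))"
proof -
  have seg: "seg \<omega> \<in> sets borel"
    by (simp add: seg_eq_closed_segment)
  have f [measurable]: "f \<in> borel_measurable borel"
    using assms(2) by (rule borel_measurable_continuous_onI)
  \<comment> \<open>As \<omega> is nonzero, \<open>t\<close> is determined by
    \<open>t *\<^sub>R \<omega>\<close>, so restricting to the segment is restricting to the unit
    interval.\<close>
  have mem: "t *\<^sub>R \<omega> \<in> seg \<omega> \<longleftrightarrow> t \<in> {0..1}" for t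
    using assms(1) by (auto simp: seg_def)
  have "(\<integral>x. f x \<partial>(seg_measure \<omega>)) = 
      (\<integral>x. indicator (seg \<omega>) x *\<^sub>R f x \<partial>(distr lborel borel (\<lambda>t. t *\<^sub>R \<omega>)))"
    unfolding seg_measure_def using seg by (subst integral_restrict_space) auto
  also have "\<dots> = (\<integral>t. indicator (seg \<omega>) (t *\<^sub>R \<omega>) *\<^sub>R f (t *\<^sub>R \<omega>) \<partial>lborel)"
    using seg by (subst integral_distr) auto
  also have "\<dots> = (LINT t:{0..1}|lborel. f (t *\<^sub>R \<omega>))"
    by (simp add: set_lebesgue_integral_def indicator_def mem)
  also have "\<dots> = integral {0..1} (\<lambda>t. f (t *\<^sub>R \<omega>))"
    by (intro set_borel_integral_eq_integral borel_integrable_atLeastAtMost'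
        continuous_on_compose2[OF assms(2)] continuous_intros) auto
  finally show ?thesis .
qed

theorem theorem2p16:
  fixes \<omega> :: "real ^ 'd::{finite,linorder}"
    and a :: "nat \<Rightarrow> complex"
  assumes "CARD('d) \<ge> 2"
    and "norm \<omega> = 1"
    and "eq_powr_o1 a"
  shows "le_powr_o1 (\<lambda>N. \<integral>x. (cmod (weyl_sum a x N))\<^sup>2 \<partial>(seg_measure \<omega>)) 1"
proof -
  have "(\<integral>x. (cmod (weyl_sum a x N))\<^sup>2 \<partial>(seg_measure \<omega>))
      = integral {0..1} (\<lambda>t. (cmod (\<Sum>n=1..N. a n * e (t * poly (line_poly \<omega>) (real n))))\<^sup>2)" for N
    unfolding weyl_sum_scaleR[symmetric]
    by (intro integral_seg_measure assms(2) continuous_intros)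
  moreover have "\<omega> \<noteq> 0"
    using assms(2) by auto
  ultimately show ?thesis
    using mean_square_exp_sum_poly[OF degree_line_poly_pos assms(3)] by simp
qed

end
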